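(* Let $p\ge 3$ be a prime and let $\mathbb{F}_p$ denote the field with $p$ elements. Let $S\subseteq\mathbb{F}_p^2$ be nonempty and let $w\colon\mathbb{F}_p^2\to\mathbb{R}$ be a function with $\operatorname{supp} w=S$. Then the number of directions in $\mathbb{F}_p^2$ that are perfect with respect to $w$ is at most $\frac12|S|$, unless $S$ is a line and $w$ is constant on $S$ (in which case exactly $p$ directions are perfect).
   Context: A direction in the affine plane $\mathbb{F}_p^2$ is a pencil (class) of $p$ parallel lines; there are $p+1$ directions. Given $w\colon\mathbb{F}_p^2\to\mathbb{R}$, a direction is called perfect with respect to $w$ if for every line $l$ in that direction one has $\sum_{z\in l} w(z)=\frac1p\sum_{z\in\mathbb{F}_p^2} w(z)$. Here $\operatorname{supp} w=\{z: w(z)\neq 0\}$. *)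

theory Defs
  imports "HOL-Analysis.Analysis" "HOL-Computational_Algebra.Primes"
begin

text \<open>
  The plane over a finite field is modelled as the type \<^typ>\<open>'a \<times> 'a\<close>, where
  \<^typ>\<open>'a\<close> is of classes \<open>field\<close> and \<open>finite\<close>. The field with \<open>p\<close> elements is any such
  \<^typ>\<open>'a\<close> with \<open>CARD('a) = p\<close>, for \<open>p\<close> prime.
\<close>

definition line_through :: "'a::field \<times> 'a \<Rightarrow> 'a \<times> 'a \<Rightarrow> ('a \<times> 'a) set" where
  "line_through z v = {(fst z + t * fst v, snd z + t * snd v) | t. True}"

text \<open>The class of all lines parallel to a given nonzero vector.\<close>

definition pencil :: "'a::field \<times> 'a \<Rightarrow> ('a \<times> 'a) set set" where
  "pencil v = {line_through z v | z. True}"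

text \<open>
  Directions are the pencils themselves, so that proportional vectors give the same direction.
\<close>

definition directions :: "('a::field \<times> 'a) set set set" where
  "directions = {pencil v | v. v \<noteq> (0, 0)}"

definition is_line :: "('a::field \<times> 'a) set \<Rightarrow> bool" where
  "is_line l \<longleftrightarrow> (\<exists>z v. v \<noteq> (0, 0) \<and> l = line_through z v)"

definition supp :: "('a::field \<times> 'a \<Rightarrow> real) \<Rightarrow> ('a \<times> 'a) set" where
  "supp w = {z. w z \<noteq> 0}"

definition perfect :: "('a::{field,finite} \<times> 'a \<Rightarrow> real) \<Rightarrow> ('a \<times> 'a) set set \<Rightarrow> bool" where
  "perfect w D \<longleftrightarrow> (\<forall>l\<in>D. (\<Sum>z\<in>l. w z) = 1 / real CARD('a) * (\<Sum>z\<in>UNIV. w z))"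

end

theory Submission
  imports Defs "HOL-Analysis.Kronecker_Approximation_Theorem"
begin

text \<open>
  Let \<open>k\<close> be the number of perfect directions. If \<open>k \<ge> p\<close>, double counting along the lines through
  a point shows that \<open>w\<close> is constant on the lines of the missing direction. So let \<open>k \<le> p - 1\<close> and
  suppose \<open>|S| < 2k\<close>. Rounding a multiple of \<open>w\<close> and dividing by powers of \<open>p\<close> gives a nonzero
  weight \<open>v\<close> with values in the field, supported in \<open>S\<close>, whose line sums in the perfect directions
  all agree. Its power sums show that \<open>v\<close> is orthogonal to all products of fewer than \<open>k\<close> affine
  functions, and this forces more than \<open>k\<close> support points on some line through each support point.
  As there are fewer than \<open>2k\<close> support points, they all lie on one line, on which \<open>v\<close> is
  then constant; so \<open>S\<close> contains this line \<open>l\<close>. Subtract from \<open>w\<close> the multiple of the indicator of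
  \<open>l\<close> that makes it vanish at a point of \<open>l\<close>. If the difference were nonzero, the same argument
  would give a second line in \<open>S\<close>, which is impossible as \<open>|S| < 2p - 1\<close>.
\<close>

section \<open>Lines as level sets\<close>

text \<open>The determinant of two vectors. For \<open>d\<close> nonzero, \<open>cross d\<close> is
  a linear form whose kernel is spanned by \<open>d\<close>, so its level sets are the lines of
  direction \<open>d\<close>, and every affine function has the form
  \<open>cross e u + c\<close>.\<close>

definition cross :: "'a::field \<times> 'a \<Rightarrow> 'a \<times> 'a \<Rightarrow> 'a" where
  "cross d z = fst d * snd z - snd d * fst z"

definition level :: "'a::field \<times> 'a \<Rightarrow> 'a \<Rightarrow> ('a \<times> 'a) set" where
  "level d s = {z. cross d z = s}"

text \<open>Once a direction \<open>m\<close> and a transversal \<open>n\<close> are fixed, the vectors \<open>n + t m\<close> represent each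
  direction other than that of \<open>m\<close> exactly once.\<close>

definition shift :: "'a::field \<times> 'a \<Rightarrow> 'a \<times> 'a \<Rightarrow> 'a \<Rightarrow> 'a \<times> 'a" where
  "shift m n t = (fst n + t * fst m, snd n + t * snd m)"

lemma mem_level [simp]: "z \<in> level d s \<longleftrightarrow> cross d z = s"
  by (simp add: level_def)

lemma cross_shift: "cross (shift m n t) z = cross n z + t * cross m z"
  unfolding cross_def shift_def fst_conv snd_conv
  by (simp only: distrib_right right_diff_distrib mult.assoc) simp

lemma cross_self [simp]: "cross d d = 0"
  by (simp add: cross_def)

lemma cross_zero [simp]: "cross d (0, 0) = 0" "cross (0, 0) d = 0"
  by (simp_all add: cross_def)

lemma cross_commute: "cross d e = - cross e d"
  by (simp add: cross_def algebra_simps)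

lemma cross_diff: "cross d (y - z) = cross d y - cross d z"
  by (simp add: cross_def algebra_simps)

lemma cross_eq_0_iff: "cross d e = 0 \<longleftrightarrow> cross e d = 0"
  using cross_commute[of d e] by simp

lemma cross_eq_0_imp_multiple:
  assumes "d \<noteq> (0, 0)" "cross d e = 0"
  obtains t where "e = (t * fst d, t * snd d)"
proof (cases "fst d = 0")
  case True
  then have "snd d \<noteq> 0" using assms(1) by (metis prod.collapse)
  moreover from this True assms(2) have "fst e = 0" by (simp add: cross_def)
  ultimately have "e = (snd e / snd d * fst d, snd e / snd d * snd d)"
    using True by (simp add: prod_eq_iff)
  then show thesis by (rule that)
next
  case False
  from assms(2) have "fst d * snd e = fst e * snd d"
    by (simp add: cross_def mult.commute)
  then have "snd e = fst e / fst d * snd d"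
    using False by (simp add: nonzero_eq_divide_eq mult.commute)
  then have "e = (fst e / fst d * fst d, fst e / fst d * snd d)"
    using False by (simp add: prod_eq_iff)
  then show thesis by (rule that)
qed

lemma line_through_eq_level:
  assumes "d \<noteq> (0, 0)"
  shows "line_through z d = level d (cross d z)"
proof (intro equalityI subsetI)
  fix y assume "y \<in> line_through z d"
  then show "y \<in> level d (cross d z)"
    by (auto simp: line_through_def cross_def algebra_simps)
next
  fix y assume "y \<in> level d (cross d z)"
  then have "cross d (y - z) = 0" by (simp add: cross_diff)
  then obtain t where "y - z = (t * fst d, t * snd d)"
    using cross_eq_0_imp_multiple[OF assms] by blast
  then have "y = (fst z + t * fst d, snd z + t * snd d)"
    by (auto simp: prod_eq_iff algebra_simps)
  then show "y \<in> line_through z d"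
    by (auto simp: line_through_def)
qed

lemma cross_surj:
  assumes "d \<noteq> (0, 0)"
  obtains z where "cross d z = s"
proof (cases "fst d = 0")
  case True
  then have "snd d \<noteq> 0" using assms(1) by (metis prod.collapse)
  then show thesis using True that[of "(- s / snd d, 0)"] by (simp add: cross_def)
next
  case False
  then show thesis using that[of "(0, s / fst d)"] by (simp add: cross_def)
qed

lemma pencil_eq_range_level:
  assumes "d \<noteq> (0, 0)"
  shows "pencil d = range (level d)"
  unfolding pencil_def line_through_eq_level[OF assms]
proof (intro equalityI subsetI)
  fix l assume "l \<in> range (level d)"
  then obtain s where s: "l = level d s" by blast
  obtain z where "cross d z = s" using cross_surj[OF assms] by blast
  with s show "l \<in> {level d (cross d z) |z. True}" by blast
qed blast

lemma is_line_iff_level: "is_line l \<longleftrightarrow> (\<exists>d s. d \<noteq> (0, 0) \<and> l = level d s)"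
proof
  assume "is_line l"
  then show "\<exists>d s. d \<noteq> (0, 0) \<and> l = level d s"
    unfolding is_line_def using line_through_eq_level by blast
next
  assume "\<exists>d s. d \<noteq> (0, 0) \<and> l = level d s"
  then obtain d s where d: "d \<noteq> (0, 0)" "l = level d s" by blast
  obtain z where "cross d z = s" using cross_surj[OF d(1)] by blast
  then show "is_line l"
    unfolding is_line_def using d line_through_eq_level[OF d(1), of z] by blast
qed

lemma pencil_eq_iff:
  assumes "d \<noteq> (0, 0)" "e \<noteq> (0, 0)"
  shows "pencil d = pencil e \<longleftrightarrow> cross d e = 0"
proof
  assume "pencil d = pencil e"
  then have "level d 0 \<in> range (level e)"
    using pencil_eq_range_level assms by blast
  then obtain s where s: "level d 0 = level e s" by blast
  then have "(0, 0) \<in> level e s" by (metis cross_zero(1) mem_level)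
  moreover have "d \<in> level e s" using s by (metis cross_self mem_level)
  ultimately show "cross d e = 0" using cross_eq_0_iff[of d e] by simp
next
  assume "cross d e = 0"
  then obtain t where t: "e = (t * fst d, t * snd d)"
    using cross_eq_0_imp_multiple[OF assms(1)] by blast
  with assms have t0: "t \<noteq> 0" by auto
  have "cross e z = t * cross d z" for z
    using t by (simp add: cross_def algebra_simps)
  then have *: "level e s = level d (s / t)" for s
    using t0 by (auto simp: nonzero_eq_divide_eq mult.commute)
  moreover have "level d s = level e (t * s)" for s
    using *[of "t * s"] t0 by simp
  ultimately have "range (level d) = range (level e)" by blast
  then show "pencil d = pencil e" by (simp add: pencil_eq_range_level assms)
qed

text \<open>Cramer's rule with determinant \<open>cross d e\<close>: two lines of different
  directions meet in exactly one point.\<close>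

lemma cross_solve:
  assumes "cross d e \<noteq> 0"
  shows "\<exists>!z. cross d z = s \<and> cross e z = t"
proof -
  define D where "D = cross d e"
  have D: "D \<noteq> 0" "D = fst d * snd e - snd d * fst e"
    using assms by (simp_all add: D_def cross_def)
  define z0 where "z0 = ((fst e * s - fst d * t) / D, (snd e * s - snd d * t) / D)"
  show ?thesis
  proof (rule ex1I[of _ z0])
    have "fst d * (snd e * s - snd d * t) - snd d * (fst e * s - fst d * t) = D * s"
      "fst e * (snd e * s - snd d * t) - snd e * (fst e * s - fst d * t) = D * t"
      unfolding D(2) by (simp_all add: left_diff_distrib right_diff_distrib mult_ac)
    then show "cross d z0 = s \<and> cross e z0 = t"
      using D(1) by (simp add: z0_def cross_def diff_divide_distrib[symmetric])
  next
    fix z assume z: "cross d z = s \<and> cross e z = t"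
    have "fst e * cross d z - fst d * cross e z = D * fst z"
      "snd e * cross d z - snd d * cross e z = D * snd z"
      unfolding D(2) cross_def by (simp_all add: left_diff_distrib right_diff_distrib mult_ac)
    then have "fst z = (fst e * s - fst d * t) / D" "snd z = (snd e * s - snd d * t) / D"
      using D(1) z by (simp_all add: nonzero_eq_divide_eq mult.commute)
    then show "z = z0"
      by (simp add: z0_def prod_eq_iff)
  qed
qed

lemma cross_nonzeroD:
  assumes "cross d e \<noteq> 0"
  shows "d \<noteq> (0, 0)" "e \<noteq> (0, 0)"
  using assms by auto

lemma exists_transversal:
  assumes "m \<noteq> (0, 0)"
  obtains n where "cross m n \<noteq> 0"
proof -
  obtain z where "cross m z = 1" using cross_surj[OF assms] by blast
  then show thesis using that[of z] by simp
qed

lemma shift_nonzero: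
  assumes "cross m n \<noteq> 0"
  shows "shift m n t \<noteq> (0, 0)"
proof -
  have "cross (shift m n t) m \<noteq> 0"
    using assms cross_eq_0_iff by (simp add: cross_shift) blast
  then show ?thesis using cross_nonzeroD by blast
qed

text \<open>Injective because the determinant of \<open>shift m n s\<close> and
  \<open>shift m n t\<close> is \<open>(t - s) * cross n m\<close>. Surjective because
  \<open>cross d (shift m n t) = 0\<close> is a linear equation in \<open>t\<close> with leading
  coefficient \<open>cross d m\<close>, nonzero when \<open>d\<close> is not parallel to
  \<open>m\<close>.\<close>

lemma bij_betw_pencil_shift:
  assumes "cross m n \<noteq> 0"
  shows "bij_betw (\<lambda>t. pencil (shift m n t)) UNIV (directions - {pencil m})"
proof -
  note m = cross_nonzeroD(1)[OF assms]
  have nm: "cross n m \<noteq> 0" using assms cross_eq_0_iff by blast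
  have *: "cross (shift m n t) m \<noteq> 0" for t
    using nm by (simp add: cross_shift)
  have "inj (\<lambda>t. pencil (shift m n t))"
  proof (rule injI)
    fix s t assume "pencil (shift m n s) = pencil (shift m n t)"
    then have "cross (shift m n s) (shift m n t) = 0"
      using pencil_eq_iff[OF shift_nonzero[OF assms] shift_nonzero[OF assms]] by blast
    moreover have "cross n (shift m n t) = t * cross n m"
      "cross m (shift m n t) = - cross n m"
      by (simp_all add: cross_def shift_def distrib_left distrib_right right_diff_distrib mult_ac)
    ultimately have "(t - s) * cross n m = 0"
      by (simp add: cross_shift left_diff_distrib)
    then show "s = t" using nm by simp
  qed
  moreover have "range (\<lambda>t. pencil (shift m n t)) = directions - {pencil m}"
  proof (intro equalityI subsetI)
    fix D assume "D \<in> range (\<lambda>t. pencil (shift m n t))"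
    then obtain t where "D = pencil (shift m n t)" by blast
    then show "D \<in> directions - {pencil m}"
      using shift_nonzero[OF assms] * pencil_eq_iff[OF shift_nonzero[OF assms] m]
      unfolding directions_def by blast
  next
    fix D assume "D \<in> directions - {pencil m}"
    then obtain d where d: "D = pencil d" "d \<noteq> (0, 0)" "cross d m \<noteq> 0"
      using pencil_eq_iff[OF _ m] unfolding directions_def by blast
    define t where "t = - cross d n / cross d m"
    have "cross d (shift m n t) = cross d n + t * cross d m"
      by (simp add: cross_def shift_def distrib_left distrib_right right_diff_distrib mult_ac)
    also have "\<dots> = 0" using d by (simp add: t_def)
    finally have "D = pencil (shift m n t)"
      using pencil_eq_iff[OF d(2) shift_nonzero[OF assms]] d by blast
    then show "D \<in> range (\<lambda>t. pencil (shift m n t))" by blast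
  qed
  ultimately show ?thesis by (simp add: bij_betw_def)
qed

section \<open>Perfect directions, and counts of directions and of points on lines\<close>

lemma perfect_pencil_iff:
  assumes "d \<noteq> (0, 0)"
  shows "perfect w (pencil d) \<longleftrightarrow>
    (\<forall>s. sum w (level d s) = 1 / real CARD('a) * sum w (UNIV :: ('a::{field,finite} \<times> 'a) set))"
  by (auto simp: perfect_def pencil_eq_range_level[OF assms])

lemma finite_directions: "finite (directions :: ('a::{field,finite} \<times> 'a) set set set)"
  by (rule finite_subset[of _ UNIV]) auto

lemma card_directions_Diff:
  assumes "m \<noteq> (0, 0)"
  shows "card (directions - {pencil (m :: 'a::{field,finite} \<times> 'a)}) = CARD('a)"
proof -
  obtain n where "cross m n \<noteq> 0" using exists_transversal[OF assms] by blast
  from bij_betw_same_card[OF bij_betw_pencil_shift[OF this]] show ?thesis by simp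
qed

lemma bij_betw_level:
  assumes "cross d e \<noteq> 0"
  shows "bij_betw (cross e) (level d s) UNIV"
proof (rule bij_betwI')
  fix x y assume "x \<in> level d s" "y \<in> level d s"
  then show "(cross e x = cross e y) = (x = y)"
    using cross_solve[OF assms, of s "cross e x"] unfolding mem_level by metis
next
  fix t
  show "\<exists>x\<in>level d s. t = cross e x"
    using cross_solve[OF assms, of s t] unfolding Bex_def mem_level by metis
qed simp

lemma card_level:
  assumes "d \<noteq> (0, 0)"
  shows "card (level d s :: ('a::{field,finite} \<times> 'a) set) = CARD('a)"
proof -
  obtain n where "cross d n \<noteq> 0" using exists_transversal[OF assms] by blast
  from bij_betw_same_card[OF bij_betw_level[OF this]] show ?thesis by blast
qed

lemma card_level_Int_le:
  assumes "level d s \<noteq> level e t" "d \<noteq> (0, 0)" "e \<noteq> (0, 0)"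
  shows "card (level d s \<inter> level e t :: ('a::{field,finite} \<times> 'a) set) \<le> 1"
proof (cases "cross d e = 0")
  case True
  then obtain c where c: "e = (c * fst d, c * snd d)"
    using cross_eq_0_imp_multiple[OF assms(2)] by blast
  with assms have c0: "c \<noteq> 0" by auto
  have *: "cross e z = c * cross d z" for z
    using c by (simp add: cross_def algebra_simps)
  have "level d s \<inter> level e t = {}"
  proof (rule ccontr)
    assume "level d s \<inter> level e t \<noteq> {}"
    then have "t = c * s" using * by auto
    then have "level e t = level d s" using * c0 by (simp add: level_def)
    then show False using assms(1) by simp
  qed
  then show ?thesis by simp
next
  case False
  obtain z where z: "\<And>y. cross d y = s \<and> cross e y = t \<Longrightarrow> y = z"
    using cross_solve[OF False, of s t] by (elim ex1E) blast
  have "level d s \<inter> level e t \<subseteq> {z}"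
  proof
    fix y assume "y \<in> level d s \<inter> level e t"
    then show "y \<in> {z}" using z[of y] by simp
  qed
  then have "card (level d s \<inter> level e t) \<le> card {z}"
    by (intro card_mono) simp_all
  then show ?thesis by simp
qed

section \<open>Power sums and the covering by pairs\<close>

text \<open>The translation by 1 permutes the field, so summing \<open>x + 1\<close> over all
  \<open>x\<close> gives the same as summing \<open>x\<close>.\<close>

lemma of_nat_CARD_eq_0: "(of_nat CARD('a::{field,finite}) :: 'a) = 0"
proof -
  have "bij (\<lambda>x :: 'a. x + 1)" by (rule bij_betwI[of _ _ _ "\<lambda>x. x - 1"]) auto
  then have "(\<Sum>x\<in>UNIV. x + 1) = (\<Sum>x\<in>UNIV. x :: 'a)"
    by (rule sum.reindex_bij_betw)
  then show ?thesis by (simp add: sum.distrib)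
qed

text \<open>The characteristic divides the prime \<open>CARD('a)\<close> and is not 1, so the two
  agree. Hence \<open>of_int\<close> is reduction modulo this prime.\<close>

lemma of_int_eq_0_iff_CARD_dvd:
  assumes "prime CARD('a::{field,finite})"
  shows "(of_int x :: 'a) = 0 \<longleftrightarrow> int CARD('a) dvd x"
proof -
  have "CHAR('a) dvd CARD('a)"
    using of_nat_CARD_eq_0 of_nat_eq_0_iff_char_dvd by blast
  moreover have "CHAR('a) \<noteq> 1"
    using of_nat_CHAR[where 'a = 'a] by auto
  ultimately have "CHAR('a) = CARD('a)"
    using assms prime_nat_iff by blast
  then show ?thesis by (simp add: of_int_eq_0_iff_char_dvd)
qed

text \<open>For positive \<open>j\<close>, the polynomial \<open>x^j - 1\<close> has at most
  \<open>j\<close> roots, so some nonzero \<open>a\<close> has \<open>a ^ j \<noteq> 1\<close>.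
  Scaling by \<open>a\<close> permutes the field but multiplies the sum by \<open>a ^ j\<close>. For
  \<open>j = 0\<close> the sum counts the field.\<close>

lemma sum_power_eq_0:
  assumes "j < CARD('a::{field,finite}) - 1"
  shows "(\<Sum>s\<in>UNIV. (s :: 'a) ^ j) = 0"
proof (cases "j = 0")
  case True
  then show ?thesis using of_nat_CARD_eq_0[where 'a = 'a] by simp
next
  case False
  define P where "P = monom (1 :: 'a) j - 1"
  have "coeff P j = 1" using False by (simp add: P_def)
  then have P0: "P \<noteq> 0" by auto
  have "degree P \<le> j" unfolding P_def
    by (rule degree_diff_le) (auto simp: degree_monom_le)
  then have "card {x. poly P x = 0} \<le> j"
    using card_poly_roots_bound[OF P0] by simp
  also have "j < card (UNIV - {0 :: 'a})" using assms by (simp add: card_Diff_singleton)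
  finally have "\<not> UNIV - {0} \<subseteq> {x. poly P x = 0}"
    using card_mono[of "{x. poly P x = 0}" "UNIV - {0}"] by (metis finite_code leD)
  then obtain a where "a \<noteq> 0" "poly P a \<noteq> 0" by blast
  then have a: "a \<noteq> 0" "a ^ j \<noteq> 1"
    by (simp_all add: P_def poly_monom)
  have "bij ((*) a)"
    by (rule bij_betwI[of _ _ _ "\<lambda>x. x / a"]) (use a in auto)
  then have "(\<Sum>s\<in>UNIV. s ^ j) = (\<Sum>s\<in>UNIV. (a * s) ^ j)"
    by (rule sum.reindex_bij_betw[symmetric])
  also have "\<dots> = a ^ j * (\<Sum>s\<in>UNIV. s ^ j)"
    by (simp add: power_mult_distrib sum_distrib_left)
  finally have "(a ^ j - 1) * (\<Sum>s\<in>UNIV. s ^ j) = 0"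
    by (simp add: left_diff_distrib)
  then show ?thesis using a by simp
qed

lemma sum_levels:
  fixes f :: "'a::{field,finite} \<times> 'a \<Rightarrow> 'b::comm_monoid_add"
  shows "(\<Sum>u\<in>UNIV. f u) = (\<Sum>s\<in>UNIV. \<Sum>u\<in>level d s. f u)"
  using sum.group[of "UNIV :: ('a \<times> 'a) set" UNIV "cross d" f] by (simp add: level_def)

text \<open>The power sum of degree \<open>j\<close> along \<open>n + t m\<close> is a polynomial in \<open>t\<close> of degree at most \<open>j\<close> that
  vanishes on \<open>T\<close>, so each of its coefficients vanishes.\<close>

lemma moments_eq_0:
  fixes v :: "'a::{field,finite} \<times> 'a \<Rightarrow> 'a"
  assumes "prime CARD('a)" and "card T \<le> CARD('a) - 1"
    and "\<And>t s. t \<in> T \<Longrightarrow> sum v (level (shift m n t) s) = c"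
    and ab: "a + b < card T"
  shows "(\<Sum>u\<in>UNIV. v u * cross m u ^ a * cross n u ^ b) = 0"
proof -
  define j where "j = a + b"
  define C where "C i = (\<Sum>u\<in>UNIV. v u * cross m u ^ i * cross n u ^ (j - i))" for i
  define P where "P = (\<Sum>i\<le>j. monom (of_nat (j choose i) * C i) i)"
  have root: "poly P t = 0" if "t \<in> T" for t
  proof -
    have "poly P t = (\<Sum>i\<le>j. of_nat (j choose i) * C i * t ^ i)"
      by (simp add: P_def poly_sum poly_monom)
    also have "\<dots> = (\<Sum>i\<le>j. \<Sum>u\<in>UNIV. v u * (of_nat (j choose i) * (t * cross m u) ^ i * cross n u ^ (j - i)))"
      by (simp add: C_def sum_distrib_left sum_distrib_right power_mult_distrib mult_ac)
    also have "\<dots> = (\<Sum>u\<in>UNIV. v u * (t * cross m u + cross n u) ^ j)"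
      by (subst sum.swap) (simp add: binomial_ring sum_distrib_left)
    also have "\<dots> = (\<Sum>u\<in>UNIV. v u * cross (shift m n t) u ^ j)"
      by (simp add: cross_shift add.commute)
    \<comment> \<open>Grouping the points by the value \<open>s\<close> leaves the line sums, all
      equal to \<open>c\<close>. What remains is a power sum over the field, which vanishes since
      \<open>j < card T \<le> CARD('a) - 1\<close>.\<close>
    also have "\<dots> = (\<Sum>s\<in>UNIV. \<Sum>u\<in>level (shift m n t) s. v u * s ^ j)"
      by (subst sum_levels[of _ "shift m n t"]) simp
    also have "\<dots> = c * (\<Sum>s\<in>UNIV. s ^ j)"
      using assms(3)[OF that] by (simp add: sum_distrib_left sum_distrib_right[symmetric])
    also have "\<dots> = 0"
      using sum_power_eq_0[where j = j and 'a = 'a] ab assms(2) by (simp add: j_def)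
    finally show ?thesis .
  qed
  have "P = 0"
  proof (rule ccontr)
    assume "P \<noteq> 0"
    have "card T \<le> card {x. poly P x = 0}"
      by (rule card_mono) (use root in auto)
    also have "\<dots> \<le> degree P" using card_poly_roots_bound \<open>P \<noteq> 0\<close> by blast
    also have "\<dots> \<le> j" unfolding P_def
      by (rule degree_sum_le) (auto intro: order_trans[OF degree_monom_le])
    finally show False using ab by (simp add: j_def)
  qed
  moreover have "coeff P a = of_nat (j choose a) * C a"
    by (simp add: P_def coeff_sum j_def)
  ultimately have "of_nat (j choose a) * C a = 0" by simp
  \<comment> \<open>The binomial coefficient divides \<open>fact j\<close> and \<open>j\<close> is
    less than the prime \<open>CARD('a)\<close>, so it can be cancelled in the field.\<close>
  moreover have "of_nat (j choose a) \<noteq> (0 :: 'a)"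
  proof
    assume "of_nat (j choose a) = (0 :: 'a)"
    then have "CARD('a) dvd j choose a"
      using of_int_eq_0_iff_CARD_dvd[OF assms(1), of "int (j choose a)"] by simp
    also have "(j choose a) dvd fact j"
      using binomial_fact_lemma[of a j] by (metis dvd_triv_right j_def le_add1)
    finally have "CARD('a) \<le> j" using prime_dvd_fact_iff[OF assms(1)] by blast
    then show False using ab assms(2) by (simp add: j_def)
  qed
  ultimately show ?thesis by (simp add: C_def j_def)
qed

lemma cross_expand:
  "cross m n * cross e u = cross e n * cross m u - cross e m * cross n u"
  unfolding cross_def by (simp add: left_diff_distrib right_diff_distrib mult_ac)

text \<open>Each form \<open>cross e\<close> is a combination of \<open>cross m\<close> and
  \<open>cross n\<close>. Expanding one affine factor therefore shortens the list while raising one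
  of \<open>a\<close>, \<open>b\<close> by at most 1, so \<open>a + b + length es\<close> never
  grows. The claim of interest is \<open>a = b = 0\<close>; general exponents make the induction
  work.\<close>

lemma orthogonal_products:
  fixes v :: "'a::{field,finite} \<times> 'a \<Rightarrow> 'a"
  assumes mn: "cross m n \<noteq> 0"
    and moments: "\<And>a b. a + b < k \<Longrightarrow> (\<Sum>u\<in>UNIV. v u * cross m u ^ a * cross n u ^ b) = 0"
  shows "a + b + length es < k \<Longrightarrow>
    (\<Sum>u\<in>UNIV. v u * cross m u ^ a * cross n u ^ b * (\<Prod>(e, c)\<leftarrow>es. cross e u + c)) = 0"
proof (induction es arbitrary: a b)
  case Nil
  then show ?case using moments by simp
next
  case (Cons ec es)
  obtain e c where ec: "ec = (e, c)" by (cases ec)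
  define \<beta> where "\<beta> = cross e n / cross m n"
  define \<gamma> where "\<gamma> = - cross e m / cross m n"
  have e: "cross e u = \<beta> * cross m u + \<gamma> * cross n u" for u
    using cross_expand[of m n e u] mn
    by (simp add: \<beta>_def \<gamma>_def nonzero_eq_divide_eq[symmetric] mult.commute diff_divide_distrib)
  let ?S = "\<lambda>a b. \<Sum>u\<in>UNIV. v u * cross m u ^ a * cross n u ^ b * (\<Prod>(e, c)\<leftarrow>es. cross e u + c)"
  have "(\<Sum>u\<in>UNIV. v u * cross m u ^ a * cross n u ^ b * (\<Prod>(e, c)\<leftarrow>ec # es. cross e u + c)) =
    \<beta> * ?S (Suc a) b + \<gamma> * ?S a (Suc b) + c * ?S a b"
    unfolding ec sum_distrib_left sum.distrib[symmetric]
    by (intro sum.cong) (simp_all add: e distrib_left distrib_right mult_ac)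
  also have "\<dots> = 0" using Cons.prems Cons.IH[of "Suc a" b] Cons.IH[of a "Suc b"] Cons.IH[of a b] by simp
  finally show ?case .
qed

lemma pair_cover:
  assumes "finite A" "card A \<le> 2 * m" "\<And>x. x \<in> A \<Longrightarrow> card {y \<in> A. f y = f x} \<le> m"
  shows "\<exists>ps. length ps \<le> m \<and> (\<forall>x\<in>A. \<exists>(y, z)\<in>set ps. x = y \<or> x = z) \<and>
    (\<forall>(x, y)\<in>set ps. x \<in> A \<and> y \<in> A \<and> (x = y \<or> f x \<noteq> f y))"
  using assms
proof (induction m arbitrary: A)
  case 0
  then show ?case by (intro exI[of _ "[]"]) simp
next
  case (Suc m)
  note fin = \<open>finite A\<close>
  define c where "c x = card {y \<in> A. f y = f x}" for x
  have maxim: "\<exists>x\<in>X. \<forall>y\<in>X. c y \<le> c x" if "X \<subseteq> A" "X \<noteq> {}" for X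
  proof -
    have X: "finite (c ` X)" "c ` X \<noteq> {}" using finite_subset[OF that(1) fin] that(2) by auto
    obtain x where "x \<in> X" "c x = Max (c ` X)" using Max_in[OF X] by (auto simp: image_iff)
    then show ?thesis using Max_ge[OF X(1)] by (intro bexI[of _ x]) auto
  qed
  show ?case
  proof (cases "A = {}")
    case True
    then show ?thesis by (intro exI[of _ "[]"]) simp
  next
    case False
    obtain x where x: "x \<in> A" "\<And>y. y \<in> A \<Longrightarrow> c y \<le> c x"
      using maxim[of A] False by blast
    have "\<exists>y\<in>A. (x = y \<or> f x \<noteq> f y) \<and> card (A - {x, y}) \<le> 2 * m \<and>
      (\<forall>z\<in>A - {x, y}. card {u \<in> A - {x, y}. f u = f z} \<le> m)"
    proof (cases "\<exists>y\<in>A. f y \<noteq> f x")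
      \<comment> \<open>All of \<open>A\<close> is one class, hence has at most \<open>m + 1\<close>
        elements, and removing \<open>x\<close> alone is enough.\<close>
      case False
      then have "{y \<in> A. f y = f x} = A" by blast
      then have "card A \<le> Suc m" using Suc.prems(3)[OF x(1)] by simp
      then have *: "card (A - {x, x}) \<le> m" using x(1) fin by (simp add: card_Diff_singleton)
      moreover have "card {u \<in> A - {x, x}. f u = f z} \<le> card (A - {x, x})" for z
        by (rule card_mono) (use fin in auto)
      then have "card {u \<in> A - {x, x}. f u = f z} \<le> m" for z
        using * le_trans by blast
      moreover from * have "card (A - {x, x}) \<le> 2 * m" by linarith
      ultimately show ?thesis using x(1) by blast
    next
      case True
      then obtain y where y: "y \<in> A" "f y \<noteq> f x" "\<And>z. z \<in> A \<Longrightarrow> f z \<noteq> f x \<Longrightarrow> c z \<le> c y"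
        using maxim[of "{y \<in> A. f y \<noteq> f x}"] by blast
      have "x \<noteq> y" using y by blast
      then have "card (A - {x, y}) \<le> 2 * m"
        using x(1) y(1) fin Suc.prems(2) by (simp add: card_Diff_subset)
      moreover have "card {u \<in> A - {x, y}. f u = f z} \<le> m" if z: "z \<in> A - {x, y}" for z
      proof -
        let ?U = "{u \<in> A - {x, y}. f u = f z}" and ?C = "{u \<in> A. f u = f z}"
        have C: "finite ?C" "card ?C \<le> Suc m" using fin Suc.prems(3) z by auto
        show ?thesis
        proof (cases "f z = f x \<or> f z = f y")
          case True
          then have "?U \<subset> ?C" using x y by auto
          then have "card ?U < card ?C" by (rule psubset_card_mono[OF C(1)])
          then show ?thesis using C(2) by linarith
        next
          case False
          \<comment> \<open>A third class loses no element. But it is no larger than the other two,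
            and the three together have at most \<open>2 * Suc m\<close> elements, so it already has
            at most \<open>m\<close>.\<close>
          let ?X = "{u \<in> A. f u = f x}" and ?Y = "{u \<in> A. f u = f y}"
          have "?X \<inter> ?Y = {}" "(?X \<union> ?Y) \<inter> ?C = {}" using False y(2) by auto
          then have "card ?X + card ?Y + card ?C = card (?X \<union> ?Y \<union> ?C)"
            using fin by (simp add: card_Un_disjoint)
          also have "\<dots> \<le> card A" by (rule card_mono) (use fin in auto)
          finally have "c x + c y + c z \<le> 2 * Suc m" using Suc.prems(2) by (simp add: c_def)
          moreover have "c z \<le> c x" "c z \<le> c y" using x y z False by auto
          ultimately have "3 * c z \<le> 2 * Suc m" by linarith
          then have "c z \<le> m" by simp
          moreover have "card ?U \<le> c z" unfolding c_def by (rule card_mono) (use fin in auto)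
          ultimately show ?thesis by linarith
        qed
      qed
      moreover from y(2) have "f x \<noteq> f y" by simp
      ultimately show ?thesis using y(1) by blast
    qed
    then obtain y where y: "y \<in> A" "x = y \<or> f x \<noteq> f y" "card (A - {x, y}) \<le> 2 * m"
      "\<And>z. z \<in> A - {x, y} \<Longrightarrow> card {u \<in> A - {x, y}. f u = f z} \<le> m" by blast
    have "finite (A - {x, y})" using fin by blast
    from Suc.IH[OF this y(3,4)] obtain ps where ps: "length ps \<le> m"
      "\<forall>u\<in>A - {x, y}. \<exists>(y, z)\<in>set ps. u = y \<or> u = z"
      "\<forall>(u, u')\<in>set ps. u \<in> A - {x, y} \<and> u' \<in> A - {x, y} \<and> (u = u' \<or> f u \<noteq> f u')"
      by blast
    show ?thesis
    proof (intro exI[of _ "(x, y) # ps"] conjI ballI)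
      fix u assume "u \<in> A"
      then show "\<exists>(y, z)\<in>set ((x, y) # ps). u = y \<or> u = z"
        using ps(2) by (cases "u \<in> {x, y}") auto
    next
      show "length ((x, y) # ps) \<le> Suc m" using ps(1) by simp
    next
      fix q assume "q \<in> set ((x, y) # ps)"
      then consider "q = (x, y)" | "q \<in> set ps" by auto
      then show "case q of (u, u') \<Rightarrow> u \<in> A \<and> u' \<in> A \<and> (u = u' \<or> f u \<noteq> f u')"
        using ps(3) x(1) y(1,2) by cases fastforce+
    qed
  qed
qed

section \<open>The support of a weight modulo p\<close>

text \<open>For \<open>x = y\<close>, take a line through \<open>x\<close> whose direction is not
  that of \<open>z - x\<close>. Otherwise take the line through \<open>x\<close> and
  \<open>y\<close>: its affine function has at \<open>z\<close> the value
  \<open>cross (x - z) (y - z)\<close>.\<close>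

lemma exists_separating_line:
  assumes "x \<noteq> z" "y \<noteq> z" "x = y \<or> cross (x - z) (y - z) \<noteq> 0"
  shows "\<exists>e c. cross e x + c = 0 \<and> cross e y + c = 0 \<and> cross e z + c \<noteq> 0"
proof (cases "x = y")
  case True
  have "z - x \<noteq> (0, 0)" using assms(1) by (simp add: zero_prod_def[symmetric])
  then obtain e where "cross (z - x) e = 1" using cross_surj by blast
  then have "cross e z - cross e x = - 1"
    using cross_commute[of e "z - x"] by (simp add: cross_diff)
  then have "cross e z + - cross e x \<noteq> 0" by simp
  moreover have "cross e x + - cross e x = 0" by simp
  ultimately show ?thesis using True by blast
next
  case False
  have "cross (y - x) y + - cross (y - x) x = 0"
    using cross_diff[of "y - x" y x] by simp
  moreover have "cross (y - x) x + - cross (y - x) x = 0" by simp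
  moreover have "cross (y - x) z + - cross (y - x) x = cross (x - z) (y - z)"
    unfolding cross_def by (simp add: left_diff_distrib right_diff_distrib mult_ac)
  ultimately show ?thesis using False assms(3) by metis
qed

text \<open>If every line through \<open>z\<close> were poor, the other support points could be paired so that the line
  through each pair avoids \<open>z\<close>; the product of these at most \<open>k - 1\<close> affine functions would isolate
  \<open>z\<close>.\<close>

lemma exists_rich_line:
  fixes v :: "'a::{field,finite} \<times> 'a \<Rightarrow> 'a"
  assumes orth: "\<And>es. length es < k \<Longrightarrow> (\<Sum>u\<in>UNIV. v u * (\<Prod>(e, c)\<leftarrow>es. cross e u + c)) = 0"
    and z: "v z \<noteq> 0" and card: "card {u. v u \<noteq> 0} < 2 * k"
  shows "\<exists>d. d \<noteq> (0, 0) \<and> k < card (level d (cross d z) \<inter> {u. v u \<noteq> 0})"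
proof (rule ccontr)
  define B where "B = {u. v u \<noteq> 0}"
  assume "\<not> ?thesis"
  then have poor: "card (level d (cross d z) \<inter> B) \<le> k" if "d \<noteq> (0, 0)" for d
    using that unfolding B_def by (meson leI)
  \<comment> \<open>For \<open>x \<noteq> z\<close> this is the line joining \<open>x\<close> to
    \<open>z\<close>, so the classes of \<open>f\<close> are the lines through
    \<open>z\<close>.\<close>
  define f where "f x = {y. cross (x - z) (y - z) = 0}" for x
  have nz: "x - z \<noteq> (0, 0)" if "x \<noteq> z" for x
    using that by (simp add: zero_prod_def[symmetric])
  have "card (B - {z}) \<le> 2 * (k - 1)"
    using card z by (simp add: B_def card_Diff_singleton)
  moreover have "card {y \<in> B - {z}. f y = f x} \<le> k - 1" if "x \<in> B - {z}" for x
  proof -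
    let ?L = "level (x - z) (cross (x - z) z) \<inter> B"
    have "y \<in> ?L - {z}" if "y \<in> B - {z}" "f y = f x" for y
    proof -
      have "y \<in> f y" by (simp add: f_def)
      then have "y \<in> f x" unfolding that(2) .
      then have "cross (x - z) (y - z) = 0" by (simp add: f_def)
      then show ?thesis using that(1) by (simp add: cross_diff)
    qed
    then have "card {y \<in> B - {z}. f y = f x} \<le> card (?L - {z})"
      by (intro card_mono) auto
    \<comment> \<open>The point \<open>z\<close> is itself a support point on this line; discarding
      it turns the bound \<open>k\<close> into the \<open>k - 1\<close> needed for the
      pairing.\<close>
    also have "\<dots> = card ?L - 1" using z by (simp add: B_def card_Diff_singleton)
    also have "\<dots> \<le> k - 1" using poor[of "x - z"] nz that by (simp add: diff_le_mono)
    finally show ?thesis .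
  qed
  ultimately have "\<exists>ps. length ps \<le> k - 1 \<and> (\<forall>x\<in>B - {z}. \<exists>(y, y')\<in>set ps. x = y \<or> x = y') \<and>
    (\<forall>(x, y)\<in>set ps. x \<in> B - {z} \<and> y \<in> B - {z} \<and> (x = y \<or> f x \<noteq> f y))"
    by (intro pair_cover) simp_all
  then obtain ps where ps: "length ps \<le> k - 1"
    "\<forall>x\<in>B - {z}. \<exists>(y, y')\<in>set ps. x = y \<or> x = y'"
    "\<forall>(x, y)\<in>set ps. x \<in> B - {z} \<and> y \<in> B - {z} \<and> (x = y \<or> f x \<noteq> f y)"
    by blast
  have "\<exists>ec. cross (fst ec) (fst q) + snd ec = 0 \<and> cross (fst ec) (snd q) + snd ec = 0 \<and>
    cross (fst ec) z + snd ec \<noteq> 0" if "q \<in> set ps" for q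
  proof -
    obtain x y where q: "q = (x, y)" by (cases q)
    have xy: "x \<noteq> z" "y \<noteq> z" "x = y \<or> f x \<noteq> f y" using ps(3) that q by auto
    have "cross (x - z) (y - z) \<noteq> 0" if "f x \<noteq> f y"
    proof
      assume "cross (x - z) (y - z) = 0"
      then obtain t where t: "y - z = (t * fst (x - z), t * snd (x - z))"
        using cross_eq_0_imp_multiple nz[OF xy(1)] by blast
      have "t \<noteq> 0"
      proof
        assume "t = 0"
        then have "y - z = (0, 0)" using t by simp
        then show False using nz[OF xy(2)] by blast
      qed
      moreover have "cross (y - z) w = t * cross (x - z) w" for w
        unfolding t by (simp add: cross_def right_diff_distrib mult_ac)
      ultimately have "f x = f y" by (simp add: f_def)
      then show False using that by blast
    qed
    then obtain e c where "cross e x + c = 0 \<and> cross e y + c = 0 \<and> cross e z + c \<noteq> 0"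
      using exists_separating_line xy by metis
    then show ?thesis unfolding q by (intro exI[of _ "(e, c)"]) simp
  qed
  then obtain h where h: "\<And>q. q \<in> set ps \<Longrightarrow> cross (fst (h q)) (fst q) + snd (h q) = 0 \<and>
    cross (fst (h q)) (snd q) + snd (h q) = 0 \<and> cross (fst (h q)) z + snd (h q) \<noteq> 0"
    by metis
  \<comment> \<open>The product vanishes at every support point except \<open>z\<close>, so its sum
    against \<open>v\<close> is the single term \<open>v z * g z\<close>.\<close>
  define g where "g u = (\<Prod>(e, c)\<leftarrow>map h ps. cross e u + c)" for u
  have g0: "g u = 0 \<longleftrightarrow> (\<exists>q\<in>set ps. cross (fst (h q)) u + snd (h q) = 0)" for u
    unfolding g_def prod_list_zero_iff set_map image_image case_prod_beta image_iff by metis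
  have "g u = 0" if "u \<in> B - {z}" for u
  proof -
    obtain q where q: "q \<in> set ps" "u = fst q \<or> u = snd q"
      using ps(2) \<open>u \<in> B - {z}\<close> unfolding case_prod_beta by blast
    then have "cross (fst (h q)) u + snd (h q) = 0" using h by metis
    then show ?thesis using q(1) g0 by blast
  qed
  then have "v u * g u = (if u = z then v z * g z else 0)" for u
    by (cases "v u = 0") (auto simp: B_def)
  then have "(\<Sum>u\<in>UNIV. v u * g u) = (\<Sum>u\<in>UNIV. if u = z then v z * g z else 0)"
    by (rule sum.cong[OF refl])
  then have "(\<Sum>u\<in>UNIV. v u * g u) = v z * g z" by simp
  moreover have "(\<Sum>u\<in>UNIV. v u * g u) = 0"
  proof -
    have "0 < k" using card by linarith
    then have "length (map h ps) < k" using ps(1) by simp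
    from orth[OF this] show ?thesis by (simp only: g_def)
  qed
  moreover have "g z \<noteq> 0"
    using h unfolding g0 by metis
  ultimately show False using z by simp
qed

text \<open>Two different rich lines would hold at least \<open>2 * (card T + 1) - 1\<close> support
  points, too many; so the rich lines through all support points coincide. The last conjunct, that
  no direction in \<open>T\<close> is parallel to this line, is what later allows subtracting its
  indicator.\<close>

lemma support_contains_line:
  fixes v :: "'a::{field,finite} \<times> 'a \<Rightarrow> 'a"
  assumes prime: "prime CARD('a)" and T: "card T \<le> CARD('a) - 1"
    and mn: "cross m n \<noteq> 0"
    and sums: "\<And>t s. t \<in> T \<Longrightarrow> sum v (level (shift m n t) s) = c"
    and z: "v z \<noteq> 0" and small: "card {u. v u \<noteq> 0} < 2 * card T"
  shows "\<exists>d s. d \<noteq> (0, 0) \<and> level d s \<subseteq> {u. v u \<noteq> 0} \<and> (\<forall>t\<in>T. cross (shift m n t) d \<noteq> 0)"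
proof -
  define B where "B = {u. v u \<noteq> 0}"
  have rich: "\<exists>d. d \<noteq> (0, 0) \<and> card T < card (level d (cross d y) \<inter> B)" if "y \<in> B" for y
    unfolding B_def
  proof (rule exists_rich_line)
    fix es :: "(('a \<times> 'a) \<times> 'a) list" assume "length es < card T"
    then show "(\<Sum>u\<in>UNIV. v u * (\<Prod>(e, c)\<leftarrow>es. cross e u + c)) = 0"
      using orthogonal_products[OF mn, of "card T" v 0 0 es] moments_eq_0[OF prime T sums] by simp
  qed (use that small in \<open>auto simp: B_def\<close>)
  obtain d where d: "d \<noteq> (0, 0)" and dB: "card T < card (level d (cross d z) \<inter> B)"
    using rich[of z] z by (auto simp: B_def)
  define L where "L = level d (cross d z)"
  have BL: "B \<subseteq> L"
  proof
    fix y assume y: "y \<in> B"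
    then obtain e where e: "e \<noteq> (0, 0)" and eB: "card T < card (level e (cross e y) \<inter> B)"
      using rich by blast
    define M where "M = level e (cross e y)"
    have "L = M"
    proof (rule ccontr)
      assume "L \<noteq> M"
      then have "card (L \<inter> M) \<le> 1" unfolding L_def M_def using card_level_Int_le d e by blast
      moreover have "card ((L \<inter> B) \<inter> (M \<inter> B)) \<le> card (L \<inter> M)" by (intro card_mono) auto
      moreover have "card (L \<inter> B) + card (M \<inter> B) =
        card ((L \<inter> B) \<union> (M \<inter> B)) + card ((L \<inter> B) \<inter> (M \<inter> B))"
        by (intro card_Un_Int) auto
      moreover have "card ((L \<inter> B) \<union> (M \<inter> B)) \<le> card B" by (intro card_mono) auto
      ultimately show False using dB eB small unfolding L_def M_def B_def by linarith
    qed
    then show "y \<in> L" by (simp add: M_def)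
  qed
  have "card (L \<inter> B) \<le> card B" by (intro card_mono) auto
  \<comment> \<open>Two parameters give two different directions, so at least one direction in
    \<open>T\<close> is transversal to \<open>L\<close>.\<close>
  then have "2 \<le> card T" using dB small unfolding L_def B_def by linarith
  then obtain t1 t2 where t12: "t1 \<in> T" "t2 \<in> T" "t1 \<noteq> t2"
    by (metis card_le_Suc0_iff_eq finite_code not_less_eq_eq numeral_2_eq_2)
  have "\<exists>t\<in>T. cross (shift m n t) d \<noteq> 0"
  proof (rule ccontr)
    assume "\<not> ?thesis"
    then have "pencil (shift m n t1) = pencil d" "pencil (shift m n t2) = pencil d"
      using t12 pencil_eq_iff[OF shift_nonzero[OF mn] d] by blast+
    then show False
      using t12(3) bij_betw_pencil_shift[OF mn] unfolding bij_betw_def inj_def by metis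
  qed
  then obtain t where t: "t \<in> T" "cross (shift m n t) d \<noteq> 0" by blast
  define e where "e = shift m n t"
  \<comment> \<open>The transversal line through \<open>y\<close> meets \<open>L\<close>, and hence
    the support, at most in \<open>y\<close>; its line sum \<open>c\<close> is thus just
    \<open>v y\<close>.\<close>
  have vL: "v y = c" if "y \<in> L" for y
  proof -
    have "u = y" if u: "u \<in> level e (cross e y)" "v u \<noteq> 0" for u
    proof -
      have "cross d u = cross d z" "cross d y = cross d z"
        using BL u(2) \<open>y \<in> L\<close> by (auto simp: B_def L_def)
      moreover have "cross e d \<noteq> 0" using t(2) by (simp add: e_def)
      ultimately show ?thesis
        using cross_solve[of e d "cross e y" "cross d z"] u(1) unfolding mem_level by metis
    qed
    then have "v u = (if u = y then v y else 0)" if "u \<in> level e (cross e y)" for u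
      using that by metis
    then have "sum v (level e (cross e y)) = (\<Sum>u\<in>level e (cross e y). if u = y then v y else 0)"
      by (rule sum.cong[OF refl])
    then show ?thesis using sums[OF t(1), of "cross e y"] by (simp add: e_def)
  qed
  have c: "c \<noteq> 0" using vL[of z] z by (simp add: L_def)
  \<comment> \<open>Were \<open>L\<close> parallel to a direction in \<open>T\<close>, its sum would
    be \<open>c\<close>; but \<open>v\<close> is constantly \<open>c\<close> on \<open>L\<close>,
    and \<open>CARD('a)\<close> copies of \<open>c\<close> add up to 0.\<close>
  have "cross (shift m n t) d \<noteq> 0" if "t \<in> T" for t
  proof
    assume "cross (shift m n t) d = 0"
    then have "pencil d = pencil (shift m n t)"
      using pencil_eq_iff[OF shift_nonzero[OF mn] d] by metis
    then have "L \<in> range (level (shift m n t))"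
      unfolding L_def pencil_eq_range_level[OF d] pencil_eq_range_level[OF shift_nonzero[OF mn]]
      by blast
    then have "c = sum v L" using sums[OF that] by auto
    also have "\<dots> = of_nat (card L) * c" using vL by simp
    also have "\<dots> = 0" unfolding L_def by (simp add: card_level[OF d] of_nat_CARD_eq_0)
    finally show False using c by blast
  qed
  moreover have "level d (cross d z) \<subseteq> {u. v u \<noteq> 0}" using vL c unfolding L_def by auto
  ultimately show ?thesis using d by blast
qed

section \<open>Real weights\<close>

text \<open>Multiply \<open>w\<close> by a suitable integer so that all values are very close to integers (simultaneous
  Dirichlet approximation); after rounding, the equations hold up to an error below 1, hence
  exactly.\<close>

lemma exists_integer_solution:
  fixes w :: "'b::finite \<Rightarrow> real" and \<L> :: "'b set set"
  assumes z: "w z \<noteq> 0" and eqs: "\<And>l. l \<in> \<L> \<Longrightarrow> real q * sum w l = sum w UNIV"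
  shows "\<exists>u :: 'b \<Rightarrow> int. u z \<noteq> 0 \<and> (\<forall>x. w x = 0 \<longrightarrow> u x = 0) \<and>
    (\<forall>l\<in>\<L>. int q * sum u l = sum u UNIV)"
proof -
  \<comment> \<open>Each value is rounded with error below \<open>1 / N\<close>, so each equation is
    off by at most \<open>(q + 1) * CARD('b) / N\<close>, which this \<open>N\<close> puts below
    1.\<close>
  define N where "N = (q + 1) * CARD('b) + 1"
  \<comment> \<open>Normalising to \<open>w' z = 1\<close> makes the rounded value at
    \<open>z\<close> equal to \<open>Q\<close>, hence nonzero.\<close>
  define w' where "w' x = w x / w z" for x
  obtain h :: "'b \<Rightarrow> nat" where h: "bij_betw h UNIV {0..<CARD('b)}"
    using ex_bij_betw_finite_nat[of "UNIV :: 'b set"] by auto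
  have "0 < N" by (simp add: N_def)
  then obtain Q r where Q: "0 < Q"
    and r: "\<And>i. i < CARD('b) \<Longrightarrow> \<bar>of_int Q * w' (inv_into UNIV h i) - of_int (r i)\<bar> < 1 / N"
    using Dirichlet_approx_simult[of N "CARD('b)" "\<lambda>i. w' (inv_into UNIV h i)"] by blast
  define u where "u x = r (h x)" for x
  have u: "\<bar>of_int Q * w' x - of_int (u x)\<bar> < 1 / N" for x
  proof -
    have "h x < CARD('b)" using h by (auto simp: bij_betw_def)
    moreover have "inv_into UNIV h (h x) = x" using h by (simp add: bij_betw_def)
    ultimately show ?thesis using r[of "h x"] by (simp add: u_def)
  qed
  have N1: "1 / real N \<le> 1" using \<open>0 < N\<close> by simp
  have "\<bar>of_int Q - of_int (u z)\<bar> < (1 :: real)"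
    using u[of z] z N1 by (simp add: w'_def)
  then have "u z = Q" by linarith
  moreover have "u x = 0" if "w x = 0" for x
    using u[of x] that N1 by (simp add: w'_def)
  moreover have "int q * sum u l = sum u UNIV" if "l \<in> \<L>" for l
  proof -
    define \<epsilon> where "\<epsilon> x = of_int Q * w' x - of_int (u x)" for x
    have eps: "\<bar>sum \<epsilon> A\<bar> \<le> CARD('b) * (1 / N)" for A
    proof -
      have "\<bar>sum \<epsilon> A\<bar> \<le> (\<Sum>x\<in>A. \<bar>\<epsilon> x\<bar>)" by (rule sum_abs)
      also have "\<dots> \<le> of_nat (card A) * (1 / N)"
        by (rule sum_bounded_above) (use u in \<open>auto simp: \<epsilon>_def intro: less_imp_le\<close>)
      also have "\<dots> \<le> CARD('b) * (1 / N)"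
        by (intro mult_right_mono) (auto intro: card_mono)
      finally show ?thesis .
    qed
    have sum_u: "of_int (sum u A) = of_int Q * sum w' A - sum \<epsilon> A" for A
      by (simp add: \<epsilon>_def sum_subtractf sum_distrib_left)
    have "sum w' A = sum w A / w z" for A
      by (simp add: w'_def sum_divide_distrib)
    then have "real q * sum w' l = sum w' UNIV" using eqs[OF that] by simp
    then have "real q * (of_int Q * sum w' l) = of_int Q * sum w' UNIV"
      by (metis mult.left_commute)
    then have "of_int (int q * sum u l - sum u UNIV) = sum \<epsilon> UNIV - real q * sum \<epsilon> l"
      by (simp only: of_int_diff of_int_mult of_int_of_nat_eq sum_u right_diff_distrib)
    also have "\<bar>\<dots>\<bar> \<le> CARD('b) * (1 / N) + real q * (CARD('b) * (1 / N))"
    proof -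
      have "\<bar>real q * sum \<epsilon> l\<bar> \<le> real q * (CARD('b) * (1 / N))"
        unfolding abs_mult abs_of_nat by (intro mult_left_mono eps) simp
      then show ?thesis using eps[of UNIV] by linarith
    qed
    also have "\<dots> = (real q + 1) * CARD('b) / N" by (simp add: distrib_right add_divide_distrib)
    also have "(real q + 1) * CARD('b) < N" by (simp add: N_def distrib_right)
    then have "(real q + 1) * CARD('b) / N < 1" using \<open>0 < N\<close> by simp
    finally have "\<bar>int q * sum u l - sum u UNIV\<bar> < 1" by linarith
    then show ?thesis by simp
  qed
  ultimately show ?thesis using Q by (intro exI[of _ u]) auto
qed

text \<open>Descent: in a solution with \<open>\<bar>u z\<bar>\<close> minimal and nonzero, not all
  values are divisible by \<open>r\<close>, since dividing by \<open>r\<close> would give a smaller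
  one. With \<open>r\<close> the prime, the reduction modulo \<open>r\<close> is not identically
  zero.\<close>

lemma exists_indivisible_integer_solution:
  fixes w :: "'b::finite \<Rightarrow> real" and \<L> :: "'b set set"
  assumes z: "w z \<noteq> 0" and eqs: "\<And>l. l \<in> \<L> \<Longrightarrow> real q * sum w l = sum w UNIV" and "1 < r"
  shows "\<exists>u :: 'b \<Rightarrow> int. (\<exists>x. \<not> r dvd u x) \<and> (\<forall>x. w x = 0 \<longrightarrow> u x = 0) \<and>
    (\<forall>l\<in>\<L>. int q * sum u l = sum u UNIV)"
proof -
  define P :: "('b \<Rightarrow> int) \<Rightarrow> bool" where "P u \<longleftrightarrow> u z \<noteq> 0 \<and> (\<forall>x. w x = 0 \<longrightarrow> u x = 0) \<and>
    (\<forall>l\<in>\<L>. int q * sum u l = sum u UNIV)" for u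
  obtain u0 where "P u0" using exists_integer_solution[OF z eqs] unfolding P_def by blast
  then obtain u where u: "P u" "\<And>u'. P u' \<Longrightarrow> nat \<bar>u z\<bar> \<le> nat \<bar>u' z\<bar>"
    using ex_has_least_nat[of P u0 "\<lambda>u. nat \<bar>u z\<bar>"] by blast
  have "\<exists>x. \<not> r dvd u x"
  proof (rule ccontr)
    assume "\<not> ?thesis"
    then have "\<forall>x. \<exists>y. u x = r * y" by (auto elim: dvdE)
    then obtain u' where u': "\<And>x. u x = r * u' x" by metis
    then have sum_u: "sum u A = r * sum u' A" for A by (simp add: sum_distrib_left)
    have "int q * sum u' l = sum u' UNIV" if "l \<in> \<L>" for l
    proof -
      have "int q * sum u l = sum u UNIV" using u(1) that unfolding P_def by blast
      then have "r * (int q * sum u' l) = r * sum u' UNIV"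
        unfolding sum_u by (simp only: mult.left_commute)
      then show ?thesis using \<open>1 < r\<close> by simp
    qed
    moreover have "u' z \<noteq> 0" "\<And>x. w x = 0 \<Longrightarrow> u' x = 0"
      using u(1) \<open>1 < r\<close> unfolding P_def u' by auto
    ultimately have "P u'" unfolding P_def by blast
    then have "\<bar>u z\<bar> \<le> \<bar>u' z\<bar>" using u(2) by fastforce
    moreover have "\<bar>u z\<bar> = r * \<bar>u' z\<bar>" unfolding u' using \<open>1 < r\<close> by (simp add: abs_mult)
    moreover have "0 < \<bar>u' z\<bar>" using \<open>u' z \<noteq> 0\<close> by simp
    ultimately show False using \<open>1 < r\<close> by simp
  qed
  then show ?thesis using u(1) unfolding P_def by blast
qed

lemma real_support_contains_line:
  fixes w :: "'a::{field,finite} \<times> 'a \<Rightarrow> real"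
  assumes prime: "prime CARD('a)" and T: "card T \<le> CARD('a) - 1"
    and mn: "cross m n \<noteq> 0"
    and perf: "\<And>t. t \<in> T \<Longrightarrow> perfect w (pencil (shift m n t))"
    and z: "w z \<noteq> 0" and small: "card (supp w) < 2 * card T"
  shows "\<exists>d s. d \<noteq> (0, 0) \<and> level d s \<subseteq> supp w \<and> (\<forall>t\<in>T. cross (shift m n t) d \<noteq> 0)"
proof -
  define \<L> where "\<L> = (\<Union>t\<in>T. range (level (shift m n t)))"
  have p: "1 < CARD('a)" using prime prime_gt_1_nat by blast
  have "real CARD('a) * sum w l = sum w UNIV" if l: "l \<in> \<L>" for l
  proof -
    obtain t s where "t \<in> T" "l = level (shift m n t) s" using l unfolding \<L>_def by blast
    then have "sum w l = 1 / real CARD('a) * sum w UNIV"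
      using perf perfect_pencil_iff[OF shift_nonzero[OF mn], of w t] by blast
    then show ?thesis using p by simp
  qed
  from exists_indivisible_integer_solution[OF z this, of \<L> "int CARD('a)"] p
  obtain u :: "'a \<times> 'a \<Rightarrow> int" where u: "\<exists>x. \<not> int CARD('a) dvd u x" "\<And>x. w x = 0 \<Longrightarrow> u x = 0"
    "\<And>l. l \<in> \<L> \<Longrightarrow> int CARD('a) * sum u l = sum u UNIV"
    by auto
  define v :: "'a \<times> 'a \<Rightarrow> 'a" where "v x = of_int (u x)" for x
  have sub: "{x. v x \<noteq> 0} \<subseteq> supp w" using u(2) by (auto simp: v_def supp_def)
  \<comment> \<open>The factor \<open>CARD('a)\<close> is cancelled over the integers, before
    reduction. Reducing the equations first would lose the information that the line sums
    agree.\<close>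
  have sums: "sum v (level (shift m n t) s) = of_int (sum u UNIV div int CARD('a))" if "t \<in> T" for t s
  proof -
    have "level (shift m n t) s \<in> \<L>" using that by (auto simp: \<L>_def)
    from u(3)[OF this, symmetric] have "sum u UNIV div int CARD('a) = sum u (level (shift m n t) s)"
      using p by simp
    then show ?thesis by (simp add: v_def)
  qed
  obtain x where x: "v x \<noteq> 0"
    using u(1) of_int_eq_0_iff_CARD_dvd[OF prime] unfolding v_def by blast
  have "card {x. v x \<noteq> 0} \<le> card (supp w)" using sub by (intro card_mono) auto
  then have "card {x. v x \<noteq> 0} < 2 * card T" using small by linarith
  from support_contains_line[OF prime T mn sums x this] sub show ?thesis by blast
qed

section \<open>Weights constant on a line\<close>

lemma perfect_pencil_line_iff:
  fixes d e :: "'a::{field,finite} \<times> 'a"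
  assumes "d \<noteq> (0, 0)" "e \<noteq> (0, 0)" "c \<noteq> 0"
  shows "perfect (\<lambda>z. if z \<in> level d s then c else 0) (pencil e) \<longleftrightarrow> cross e d \<noteq> 0"
proof -
  let ?w = "\<lambda>z. if z \<in> level d s then c else 0"
  have sum_w: "sum ?w A = card (A \<inter> level d s) * c" for A
    by (simp del: mem_level flip: sum.inter_restrict)
  have p: "1 < CARD('a)"
    using card_mono[of UNIV "{0, 1 :: 'a}"] by simp
  \<comment> \<open>The total weight is \<open>CARD('a) * c\<close>, so the prescribed line sum is
    \<open>c\<close>: each line of the pencil must contain exactly one point of
    \<open>level d s\<close>.\<close>
  have perf: "perfect ?w (pencil e) \<longleftrightarrow> (\<forall>r. card (level e r \<inter> level d s) = 1)"
    unfolding perfect_pencil_iff[OF assms(2)] sum_w using assms p by (simp add: card_level)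
  show ?thesis
  proof (cases "cross e d = 0")
    case True
    then have "level d s \<in> range (level e)"
      using pencil_eq_iff[OF assms(2,1)] pencil_eq_range_level[OF assms(1)]
        pencil_eq_range_level[OF assms(2)] by blast
    then obtain r where "level e r = level d s" by auto
    then have "card (level e r \<inter> level d s) = CARD('a)" by (simp add: card_level[OF assms(1)])
    then show ?thesis unfolding perf using True p by (metis less_numeral_extra(4))
  next
    case False
    have "card (level e r \<inter> level d s) = 1" for r
    proof -
      obtain z where "cross e z = r" "cross d z = s"
        and "\<And>y. cross e y = r \<and> cross d y = s \<Longrightarrow> y = z"
        using cross_solve[OF False, of r s] by blast
      then have "level e r \<inter> level d s = {z}" unfolding level_def by blast
      then show ?thesis by simp
    qed
    then show ?thesis unfolding perf using False by blast
  qed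
qed

lemma perfect_diff:
  assumes "perfect f D" "perfect g D"
  shows "perfect (\<lambda>z. f z - g z) D"
  using assms unfolding perfect_def by (simp add: sum_subtractf right_diff_distrib diff_divide_distrib)

lemma weight_constant_on_line:
  fixes w :: "'a::{field,finite} \<times> 'a \<Rightarrow> real"
  assumes prime: "prime CARD('a)" and z: "w z \<noteq> 0"
    and few: "card {D \<in> directions. perfect w D} \<le> CARD('a) - 1"
    and small: "card (supp w) < 2 * card {D \<in> directions. perfect w D}"
  shows "\<exists>d s c. d \<noteq> (0, 0) \<and> w = (\<lambda>z. if z \<in> level d s then c else 0)"
proof -
  define K where "K = {D \<in> directions. perfect w D}"
  have p: "1 < CARD('a)" using prime prime_gt_1_nat by blast
  \<comment> \<open>Some direction \<open>m\<close> is not perfect. Taking it as the exceptional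
    one, all perfect directions are of the form \<open>pencil (shift m n t)\<close>.\<close>
  have "\<not> directions \<subseteq> K"
  proof
    assume "directions \<subseteq> K"
    then have "directions - {pencil (1, 0 :: 'a)} \<subseteq> K" by blast
    from card_mono[OF _ this] have "CARD('a) \<le> card K"
      using card_directions_Diff[of "(1, 0 :: 'a)"] by simp
    then show False using few p by (simp add: K_def)
  qed
  then obtain m where m: "m \<noteq> (0, 0)" "pencil m \<notin> K" unfolding directions_def by blast
  obtain n where mn: "cross m n \<noteq> 0" using exists_transversal[OF m(1)] by blast
  note bij = bij_betw_pencil_shift[OF mn]
  define T where "T = {t. pencil (shift m n t) \<in> K}"
  have "(\<lambda>t. pencil (shift m n t)) ` T = K"
  proof
    show "K \<subseteq> (\<lambda>t. pencil (shift m n t)) ` T"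
    proof
      fix D assume D: "D \<in> K"
      then have "D \<in> directions - {pencil m}" using m(2) by (auto simp: K_def)
      then obtain t where "D = pencil (shift m n t)"
        using bij unfolding bij_betw_def by blast
      then show "D \<in> (\<lambda>t. pencil (shift m n t)) ` T" using D unfolding T_def by blast
    qed
  qed (auto simp: T_def)
  moreover have "inj_on (\<lambda>t. pencil (shift m n t)) T"
    using bij unfolding bij_betw_def by (meson inj_on_subset subset_UNIV)
  ultimately have T: "card T = card K" using card_image by metis
  have perf: "perfect w (pencil (shift m n t))" if "t \<in> T" for t
    using that by (simp add: T_def K_def)
  have cardT: "card T \<le> CARD('a) - 1" and small: "card (supp w) < 2 * card T"
    using few small T by (simp_all add: K_def)
  obtain d s where d: "d \<noteq> (0, 0)" "level d s \<subseteq> supp w" "\<forall>t\<in>T. cross (shift m n t) d \<noteq> 0"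
    using real_support_contains_line[OF prime cardT mn perf z small] by blast
  obtain z0 where z0: "cross d z0 = s" using cross_surj[OF d(1)] by blast
  define c where "c = w z0"
  have c: "c \<noteq> 0" using d(2) z0 by (auto simp: c_def supp_def)
  define w' where "w' y = w y - (if y \<in> level d s then c else 0)" for y
  have "w' y = 0" for y
  proof (rule ccontr)
    assume y: "w' y \<noteq> 0"
    \<comment> \<open>Since the line lies in \<open>supp w\<close>, subtracting on it creates no new
      support points; the directions in \<open>T\<close> stay perfect because none is parallel to
      the line.\<close>
    have sub: "supp w' \<subseteq> supp w" using d(2) by (auto simp: supp_def w'_def)
    then have "card (supp w') \<le> card (supp w)" by (intro card_mono) auto
    then have small': "card (supp w') < 2 * card T" using small by linarith
    have perf': "perfect w' (pencil (shift m n t))" if "t \<in> T" for t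
      unfolding w'_def using perf[OF that]
        perfect_pencil_line_iff[OF d(1) shift_nonzero[OF mn] c] d(3) that
      by (intro perfect_diff) blast+
    obtain e r where e: "e \<noteq> (0, 0)" "level e r \<subseteq> supp w'"
      using real_support_contains_line[OF prime cardT mn perf' y small'] by blast
    \<comment> \<open>The second line misses \<open>z0\<close>, so it differs from the first.
      Together they have at least \<open>2 * CARD('a) - 1\<close> points, whereas
      \<open>card (supp w) < 2 * card T \<le> 2 * (CARD('a) - 1)\<close>.\<close>
    have "w' z0 = 0" using z0 by (simp add: w'_def c_def)
    then have "z0 \<notin> level e r" using e(2) unfolding supp_def by blast
    then have "level d s \<noteq> level e r" using z0 by auto
    from card_level_Int_le[OF this d(1) e(1)]
    have "card (level d s \<inter> level e r) \<le> 1" .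
    moreover have "card (level d s) + card (level e r) =
      card (level d s \<union> level e r) + card (level d s \<inter> level e r)"
      by (intro card_Un_Int) auto
    moreover have "card (level d s \<union> level e r) \<le> card (supp w)"
      using d(2) e(2) sub by (intro card_mono) auto
    ultimately show False
      using small cardT by (simp add: card_level d(1) e(1))
  qed
  then have "w = (\<lambda>z. if z \<in> level d s then c else 0)" by (simp add: w'_def fun_eq_iff)
  then show ?thesis using d(1) by blast
qed

text \<open>Add up the sums over the \<open>CARD('a)\<close> lines through \<open>z\<close> not of
  direction \<open>m\<close>; together they give the total weight. They cover each point off the
  \<open>m\<close>-line through \<open>z\<close> once, the other points of that line never, and
  \<open>z\<close> itself \<open>CARD('a)\<close> times.\<close>

lemma weight_eq_line_average:
  fixes w :: "'a::{field,finite} \<times> 'a \<Rightarrow> real"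
  assumes m: "m \<noteq> (0, 0)" and perf: "\<And>D. D \<in> directions - {pencil m} \<Longrightarrow> perfect w D"
  shows "w z = sum w (level m (cross m z)) / real CARD('a)"
proof -
  obtain n where mn: "cross m n \<noteq> 0" using exists_transversal[OF m] by blast
  let ?L = "\<lambda>t. level (shift m n t) (cross (shift m n t) z)"
  have "sum w (?L t) = 1 / real CARD('a) * sum w UNIV" for t
  proof -
    have "pencil (shift m n t) \<in> directions - {pencil m}"
      using bij_betw_pencil_shift[OF mn] unfolding bij_betw_def by blast
    then show ?thesis using perf perfect_pencil_iff[OF shift_nonzero[OF mn]] by blast
  qed
  then have "sum w UNIV = (\<Sum>t\<in>UNIV. sum w (?L t))" by simp
  also have "\<dots> = (\<Sum>t\<in>UNIV. \<Sum>u\<in>UNIV. if u \<in> ?L t then w u else 0)"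
    by (simp del: mem_level flip: sum.inter_restrict)
  also have "\<dots> = (\<Sum>u\<in>UNIV. \<Sum>t\<in>UNIV. if u \<in> ?L t then w u else 0)"
    by (rule sum.swap)
  also have "\<dots> = (\<Sum>u\<in>UNIV. w u - (if u \<in> level m (cross m z) then w u else 0) +
      (if u = z then real CARD('a) * w z else 0))"
  proof (rule sum.cong[OF refl])
    fix u
    have L: "u \<in> ?L t \<longleftrightarrow> (cross n u - cross n z) + t * (cross m u - cross m z) = 0" for t
    proof -
      have *: "(cross n u - cross n z) + t * (cross m u - cross m z) =
        (cross n u + t * cross m u) - (cross n z + t * cross m z)"
        by (simp add: right_diff_distrib)
      show ?thesis unfolding mem_level cross_shift * by (rule eq_iff_diff_eq_0)
    qed
    show "(\<Sum>t\<in>UNIV. if u \<in> ?L t then w u else 0) =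
      w u - (if u \<in> level m (cross m z) then w u else 0) + (if u = z then real CARD('a) * w z else 0)"
    proof (cases "cross m u = cross m z")
      case True
      show ?thesis
      proof (cases "u = z")
        case False
        then have "cross n u \<noteq> cross n z"
          using cross_solve[OF mn, of "cross m z" "cross n z"] True by metis
        then show ?thesis unfolding L using True False by simp
      qed simp
    next
      case False
      \<comment> \<open>The parameter of the direction of the line joining \<open>u\<close> and
        \<open>z\<close>.\<close>
      define t0 where "t0 = - (cross n u - cross n z) / (cross m u - cross m z)"
      have "u \<in> ?L t \<longleftrightarrow> t = t0" for t
        unfolding L t0_def using False
        by (simp add: eq_divide_eq add_eq_0_iff)
      then show ?thesis using False by auto
    qed
  qed
  also have "\<dots> = sum w UNIV - sum w (level m (cross m z)) + real CARD('a) * w z"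
    by (simp add: sum.distrib sum_subtractf del: mem_level flip: sum.inter_restrict)
  finally show ?thesis by (simp add: nonzero_eq_divide_eq mult.commute)
qed

section \<open>Counting perfect directions\<close>

lemma constant_along_line:
  fixes w :: "'a::{field,finite} \<times> 'a \<Rightarrow> real"
  assumes "m \<noteq> (0, 0)" and "\<And>D. D \<in> directions - {pencil m} \<Longrightarrow> perfect w D"
    and "cross m y = cross m z"
  shows "w y = w z"
  using weight_eq_line_average[OF assms(1,2), of y] weight_eq_line_average[OF assms(1,2), of z] assms(3)
  by simp

lemma perfect_directions_of_line:
  fixes w :: "'a::{field,finite} \<times> 'a \<Rightarrow> real"
  assumes "is_line (supp w)" "w constant_on (supp w)"
  shows "card {D \<in> directions. perfect w D} = CARD('a)"
proof -
  obtain d s where d: "d \<noteq> (0, 0)" "supp w = level d s"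
    using assms(1) is_line_iff_level by blast
  obtain c where c: "\<And>z. z \<in> supp w \<Longrightarrow> w z = c"
    using assms(2) unfolding constant_on_def by blast
  obtain z where "cross d z = s" using cross_surj[OF d(1)] by blast
  then have "z \<in> supp w" using d(2) by simp
  then have "c \<noteq> 0" using c[of z] by (simp add: supp_def)
  have "w z = (if z \<in> level d s then c else 0)" for z
    unfolding d(2)[symmetric] using c[of z] by (cases "z \<in> supp w") (simp_all add: supp_def)
  then have w: "w = (\<lambda>z. if z \<in> level d s then c else 0)" by blast
  have "perfect w D \<longleftrightarrow> D \<noteq> pencil d" if D: "D \<in> directions" for D
  proof -
    obtain e where e: "e \<noteq> (0, 0)" "D = pencil e" using D unfolding directions_def by blast
    show ?thesis
      unfolding w e(2) perfect_pencil_line_iff[OF d(1) e(1) \<open>c \<noteq> 0\<close>] pencil_eq_iff[OF e(1) d(1)]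
      by simp
  qed
  then have "{D \<in> directions. perfect w D} = directions - {pencil d}" by blast
  then show ?thesis using card_directions_Diff[OF d(1)] by simp
qed

lemma twice_perfect_directions_le:
  fixes w :: "'a::{field,finite} \<times> 'a \<Rightarrow> real"
  assumes prime: "prime CARD('a)" and p3: "3 \<le> CARD('a)" and ne: "supp w \<noteq> {}"
    and nonline: "\<not> (is_line (supp w) \<and> w constant_on (supp w))"
  shows "2 * card {D \<in> directions. perfect w D} \<le> card (supp w)"
proof -
  define K where "K = {D \<in> directions. perfect w D}"
  obtain z where z: "w z \<noteq> 0" using ne by (auto simp: supp_def)
  have dirs: "card (directions :: ('a \<times> 'a) set set set) = CARD('a) + 1"
  proof -
    have "(1 :: 'a, 0 :: 'a) \<noteq> (0, 0)" by simp
    then have "pencil (1, 0 :: 'a) \<in> directions" unfolding directions_def by blast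
    then show ?thesis
      using card_directions_Diff[of "(1, 0 :: 'a)"] p3 by (simp add: card_Diff_singleton)
  qed
  consider "card K \<le> CARD('a) - 1" | "K = directions" | "card K = CARD('a)"
  proof -
    have "card K \<le> CARD('a) + 1"
      using card_mono[of directions K] finite_directions dirs by (auto simp: K_def)
    moreover have "K = directions" if "card K = CARD('a) + 1"
      using that dirs by (intro card_subset_eq) (auto simp: K_def)
    ultimately show thesis using that by linarith
  qed
  then show ?thesis
  proof cases
    case 1
    show ?thesis
    proof (rule ccontr)
      assume "\<not> ?thesis"
      then obtain d s c where d: "d \<noteq> (0, 0)" and w: "w = (\<lambda>z. if z \<in> level d s then c else 0)"
        using weight_constant_on_line[of w z] prime z 1 unfolding K_def not_le by blast
      have "c \<noteq> 0" using z w by metis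
      then have "supp w = level d s" unfolding w supp_def by auto
      moreover have "w constant_on level d s" unfolding constant_on_def w by auto
      moreover have "is_line (level d s)" unfolding is_line_iff_level using d by blast
      ultimately show False using nonline by simp
    qed
  next
    case 2
    \<comment> \<open>With every direction perfect, any direction can play the part of the
      exceptional one, so \<open>w\<close> is constant along all lines.\<close>
    have all: "w y = w x" if "m \<noteq> (0, 0)" "cross m y = cross m x" for m x y
      using constant_along_line[OF that(1) _ that(2), of w] 2 unfolding K_def by blast
    have "w y = w z" for y
    proof -
      have "cross (1, 0) (0, 1 :: 'a) \<noteq> 0" by (simp add: cross_def)
      \<comment> \<open>The corner between \<open>y\<close> and \<open>z\<close>, reached from each
        along a coordinate direction.\<close>
      then obtain x where "cross (1, 0) x = cross (1, 0) y" "cross (0, 1) x = cross (0, 1) z"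
        using cross_solve by blast
      moreover have "(1 :: 'a, 0 :: 'a) \<noteq> (0, 0)" "(0 :: 'a, 1 :: 'a) \<noteq> (0, 0)" by simp_all
      ultimately have "w x = w y" "w x = w z" using all by blast+
      then show ?thesis by simp
    qed
    then have "w y \<noteq> 0" for y using z by metis
    then have "supp w = UNIV" by (simp add: supp_def)
    then have "card (supp w) = CARD('a) * CARD('a)"
      by (simp add: UNIV_Times_UNIV[symmetric] card_cartesian_product del: UNIV_Times_UNIV)
    moreover have "3 * CARD('a) \<le> CARD('a) * CARD('a)" using p3 by (intro mult_right_mono) auto
    moreover have "card K = CARD('a) + 1" using 2 dirs by simp
    ultimately show ?thesis using p3 unfolding K_def by linarith
  next
    case 3
    have "card (directions - K) = 1"
      using 3 dirs by (subst card_Diff_subset) (auto simp: K_def)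
    then obtain D where D: "directions - K = {D}" using card_1_singletonE by blast
    then have "D \<in> directions" by blast
    then obtain m where m: "m \<noteq> (0, 0)" "D = pencil m" unfolding directions_def by blast
    \<comment> \<open>The support is now a union of lines of direction \<open>m\<close>. A single
      such line is the excluded case, so there are at least two, with \<open>2 * CARD('a)\<close>
      points.\<close>
    have along: "w y = w x" if "cross m y = cross m x" for x y
      using constant_along_line[OF m(1) _ that, of w] D m(2) unfolding K_def by blast
    have sub: "level m (cross m x) \<subseteq> supp w" if "x \<in> supp w" for x
    proof
      fix y assume "y \<in> level m (cross m x)"
      then have "w y = w x" by (intro along) simp
      then show "y \<in> supp w" using that by (simp add: supp_def)
    qed
    have zS: "z \<in> supp w" using z by (simp add: supp_def)
    have "w constant_on level m (cross m z)"
      unfolding constant_on_def using along mem_level by blast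
    moreover have "is_line (level m (cross m z))" unfolding is_line_iff_level using m(1) by blast
    ultimately have "supp w \<noteq> level m (cross m z)" using nonline by metis
    then obtain y where y: "y \<in> supp w" "cross m y \<noteq> cross m z"
      using sub[OF zS] unfolding level_def by blast
    have "level m (cross m z) \<inter> level m (cross m y) = {}" using y(2) by auto
    then have "2 * CARD('a) = card (level m (cross m z) \<union> level m (cross m y))"
      by (subst card_Un_disjoint) (simp_all add: card_level[OF m(1)])
    also have "\<dots> \<le> card (supp w)" using sub[OF zS] sub[OF y(1)] by (intro card_mono) auto
    finally show ?thesis using 3 by (simp add: K_def)
  qed
qed

theorem theorem1:
  fixes p :: nat
    and S :: "('a::{field,finite} \<times> 'a) set"
    and w :: "'a \<times> 'a \<Rightarrow> real"
  assumes "prime p" and "p \<ge> 3" and "CARD('a) = p"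
    and "S \<noteq> {}" and "supp w = S"
  shows "(\<not> (is_line S \<and> w constant_on S) \<longrightarrow>
            real (card {D \<in> directions. perfect w D}) \<le> 1 / 2 * real (card S)) \<and>
         (is_line S \<and> w constant_on S \<longrightarrow>
            card {D \<in> directions. perfect w D} = p)"
proof (intro conjI impI)
  assume "\<not> (is_line S \<and> w constant_on S)"
  then have "2 * card {D \<in> directions. perfect w D} \<le> card S"
    using twice_perfect_directions_le[of w] assms by simp
  then show "real (card {D \<in> directions. perfect w D}) \<le> 1 / 2 * real (card S)" by simp
next
  assume "is_line S \<and> w constant_on S"
  then show "card {D \<in> directions. perfect w D} = p"
    using perfect_directions_of_line[of w] assms by simp
qed

end
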